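(* There is an $n$-optimal matrix of partitions for every natural number $n>1$.
   Context: $\omega$ is the set of natural numbers, and each natural number $n$ is identified with $\{0,\ldots,n-1\}$. For $n\in\omega$, an $n$-optimal matrix of partitions is a family $(P_{k,m}\mid k\in\omega,\ m<n)$ of infinite partitions $P_{k,m}=(a^{k,m}_i\mid i\in\omega)$ of $\omega$ (each partition has infinitely many pieces, enumerated by $i\in\omega$) with the following properties. (i) Column-wise agreement: for all $m<n$, all $k\in\omega$ and all $i:k\to\omega$, the intersection $\bigcap_{\ell<k}a^{\ell,m}_{i(\ell)}$ is infinite (the empty intersection being $\omega$). (ii) $n$-optimality: for all maps $(i,k,m):n\to\omega\times\omega\times n$ with $(k(j),m(j))\neq(k(\ell),m(\ell))$ for all $j<\ell<n$ and $m(j)\neq m(\ell)$ for at least one pair $j,\ell<n$, the intersection $\bigcap_{j<n}a^{k(j),m(j)}_{i(j)}$ is a singleton. *)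

theory Defs
  imports Main "HOL-Library.Disjoint_Sets"
begin

text \<open>An infinite partition of the natural numbers, given as an enumeration of its pieces without
  repetition; injectivity makes the number of pieces infinite, and
  \<^const>\<open>partition_on\<close> makes every piece nonempty.\<close>

definition infinite_partition :: "(nat \<Rightarrow> nat set) \<Rightarrow> bool" where
  "infinite_partition a \<longleftrightarrow> partition_on UNIV (range a) \<and> inj a"

text \<open>\<open>P k m i\<close> is the piece of index \<open>i\<close> of the partition in row \<open>k\<close> and column \<open>m\<close>; the
  values of \<open>P\<close> at columns \<open>m \<ge> n\<close> are irrelevant. Maps with domain \<open>n = {0, \<dots>, n - 1}\<close> are
  represented by total functions of which only the values on \<open>{..<n}\<close> are used.\<close>

definition columnwise_agreement :: "nat \<Rightarrow> (nat \<Rightarrow> nat \<Rightarrow> nat \<Rightarrow> nat set) \<Rightarrow> bool" where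
  "columnwise_agreement n P \<longleftrightarrow>
    (\<forall>m<n. \<forall>k. \<forall>i :: nat \<Rightarrow> nat. infinite (\<Inter>l<k. P l m (i l)))"

definition n_optimality :: "nat \<Rightarrow> (nat \<Rightarrow> nat \<Rightarrow> nat \<Rightarrow> nat set) \<Rightarrow> bool" where
  "n_optimality n P \<longleftrightarrow>
    (\<forall>i k m :: nat \<Rightarrow> nat.
      (\<forall>j<n. m j < n) \<longrightarrow>
      (\<forall>l<n. \<forall>j<l. (k j, m j) \<noteq> (k l, m l)) \<longrightarrow>
      (\<exists>j<n. \<exists>l<n. m j \<noteq> m l) \<longrightarrow>
      is_singleton (\<Inter>j<n. P (k j) (m j) (i j)))"

definition optimal_matrix :: "nat \<Rightarrow> (nat \<Rightarrow> nat \<Rightarrow> nat \<Rightarrow> nat set) \<Rightarrow> bool" where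
  "optimal_matrix n P \<longleftrightarrow>
    (\<forall>k. \<forall>m<n. infinite_partition (P k m)) \<and> columnwise_agreement n P \<and> n_optimality n P"

end

theory Submission imports Defs "HOL-Library.Countable_Set"
begin

text \<open>
  A matrix of partitions is the same thing as a sequence \<open>F\<close> of functions: a point \<open>x\<close> is identified
  with the function \<open>F x\<close> that sends each coordinate \<open>(k, m)\<close> to the index of the piece of \<open>P k m\<close>
  containing \<open>x\<close>. Both properties of the matrix say that certain finite constraints, that is, finite
  partial maps from coordinates to indices, are extended by suitably many of these functions:
  infinitely many if the constraint lives in one column, exactly one if it has \<open>n\<close> coordinates in at
  least two columns.

  There are only countably many such constraints, so the points can be added one by one while running
  through an enumeration that repeats every constraint infinitely often
  (\<open>countable_enumerated_infinitely_often\<close>). One-column constraints are obeyed each time they come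
  up; the other ones are obeyed only if no earlier point extends them. At every coordinate where the
  new point is not bound by an obeyed constraint, it takes a value that no earlier point has there
  (\<open>exists_sequence_serving_constraints\<close>). Two points then agree only inside the constraint of the
  later one. If that constraint lies in one column, the agreement does too. If it has at most \<open>n\<close>
  coordinates and the two points agree on \<open>n\<close> of them, then they agree on all of them, so the earlier
  point already extended the constraint and it would not have been obeyed again. Hence no two points
  agree on \<open>n\<close> coordinates from different columns, which is the uniqueness part of optimality; the
  remaining claims hold because every constraint is served.
\<close>

text \<open>
  The recursion behind the theorem. Coordinates outside the constraint, and all coordinates at a step
  whose constraint is skipped, receive fresh values; this is what the last property records.
\<close>

lemma exists_sequence_serving_constraints:
  fixes p :: "nat \<Rightarrow> 'c \<rightharpoonup> nat" and forced :: "nat \<Rightarrow> bool"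
  obtains F :: "nat \<Rightarrow> 'c \<Rightarrow> nat" where
    "\<And>x. forced x \<Longrightarrow> p x \<subseteq>\<^sub>m Some \<circ> F x"
    "\<And>x. \<exists>y\<le>x. p x \<subseteq>\<^sub>m Some \<circ> F y"
    "\<And>x y c. y < x \<Longrightarrow> F x c = F y c \<Longrightarrow>
      c \<in> dom (p x) \<and> (forced x \<or> (\<forall>z<x. \<not> p x \<subseteq>\<^sub>m Some \<circ> F z))"
proof -
  define obeyed where
    "obeyed F x \<longleftrightarrow> forced x \<or> (\<forall>z<x. \<not> p x \<subseteq>\<^sub>m Some \<circ> F z)" for F :: "nat \<Rightarrow> 'c \<Rightarrow> nat" and x
  define good where
    "good F x f \<longleftrightarrow> (obeyed F x \<longrightarrow> p x \<subseteq>\<^sub>m Some \<circ> f) \<and>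
      (\<forall>y<x. \<forall>c. f c = F y c \<longrightarrow> c \<in> dom (p x) \<and> obeyed F x)"
    for F :: "nat \<Rightarrow> 'c \<Rightarrow> nat" and x f
  have "\<exists>F. \<forall>x. good F x (F x)"
  proof (rule dependent_wf_choice[OF wf_less])
    fix F G :: "nat \<Rightarrow> 'c \<Rightarrow> nat" and x f
    assume "\<And>z. (z, x) \<in> {(x, y). x < y} \<Longrightarrow> F z = G z"
    then have "\<And>z. z < x \<Longrightarrow> F z = G z" by simp
    then show "good F x f = good G x f"
      by (simp add: good_def obeyed_def)
  next
    fix x and F :: "nat \<Rightarrow> 'c \<Rightarrow> nat"
    define f where "f c = (if obeyed F x \<and> c \<in> dom (p x) then the (p x c)
                           else Suc (\<Sum>y<x. F y c))" for c
    have "F y c < Suc (\<Sum>y<x. F y c)" if "y < x" for y c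
      using that member_le_sum[of y "{..<x}" "\<lambda>y. F y c"] by simp
    then have "f c \<noteq> F y c" if "y < x" "\<not> (obeyed F x \<and> c \<in> dom (p x))" for y c
      using that unfolding f_def by (metis less_irrefl)
    moreover have "p x \<subseteq>\<^sub>m Some \<circ> f" if "obeyed F x"
      using that by (auto simp: map_le_def f_def)
    ultimately show "\<exists>f. good F x f"
      unfolding good_def by blast
  qed
  then obtain F where F: "\<And>x. good F x (F x)" by blast
  show thesis
  proof
    show "p x \<subseteq>\<^sub>m Some \<circ> F x" if "forced x" for x
      using F[of x] that by (simp add: good_def obeyed_def)
    show "\<exists>y\<le>x. p x \<subseteq>\<^sub>m Some \<circ> F y" for x
      using F[of x] unfolding good_def obeyed_def by (meson less_imp_le order_refl)
    show "c \<in> dom (p x) \<and> (forced x \<or> (\<forall>z<x. \<not> p x \<subseteq>\<^sub>m Some \<circ> F z))"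
      if "y < x" "F x c = F y c" for x y c
      using F[of x] that unfolding good_def obeyed_def by blast
  qed
qed

lemma countable_finite_maps:
  "countable {q :: 'c::countable \<rightharpoonup> 'd::countable. finite (dom q)}"
proof (rule countable_subset)
  show "{q :: 'c \<rightharpoonup> 'd. finite (dom q)} \<subseteq> range map_of"
    using map_of_map_keys finite_list by (metis (no_types, lifting) mem_Collect_eq rangeI subsetI)
qed simp

text \<open>
  Enumerating \<open>R \<times> UNIV\<close> and forgetting the second component repeats every element of \<open>R\<close>, which is
  how a constraint gets served infinitely often.
\<close>

lemma countable_enumerated_infinitely_often:
  assumes "countable R" "R \<noteq> {}"
  obtains p :: "nat \<Rightarrow> 'a" where "range p \<subseteq> R" "\<And>r. r \<in> R \<Longrightarrow> infinite {x. p x = r}"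
proof
  let ?e = "from_nat_into (R \<times> (UNIV :: nat set))"
  have e: "range ?e = R \<times> UNIV"
    using assms by (intro range_from_nat_into) auto
  show "range (fst \<circ> ?e) \<subseteq> R"
  proof clarify
    fix x
    have "?e x \<in> R \<times> UNIV"
      using e by blast
    then show "(fst \<circ> ?e) x \<in> R"
      by (auto simp: mem_Times_iff)
  qed
  show "infinite {x. (fst \<circ> ?e) x = r}" if "r \<in> R" for r
  proof
    assume "finite {x. (fst \<circ> ?e) x = r}"
    moreover have "UNIV \<subseteq> (snd \<circ> ?e) ` {x. (fst \<circ> ?e) x = r}"
    proof
      fix j :: nat
      have "(r, j) \<in> range ?e"
        unfolding e using that by simp
      then obtain x where x: "(r, j) = ?e x" ..
      show "j \<in> (snd \<circ> ?e) ` {x. (fst \<circ> ?e) x = r}"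
        by (rule image_eqI[of _ _ x]) (simp_all flip: x)
    qed
    ultimately show False
      using finite_surj[of _ UNIV "snd \<circ> ?e"] infinite_UNIV_nat by simp
  qed
qed

lemma infinite_partition_fibres:
  assumes "surj f"
  shows "infinite_partition (\<lambda>i. {x. f x = i})"
  unfolding infinite_partition_def
proof
  have nonempty: "{x. f x = i} \<noteq> {}" for i
    using assms by (metis (mono_tags) empty_Collect_eq surjD)
  show "partition_on UNIV (range (\<lambda>i. {x. f x = i}))"
    using nonempty by (intro partition_onI) (auto simp: disjnt_def)
  show "inj (\<lambda>i. {x. f x = i})"
    using nonempty by (intro injI) (metis (mono_tags) Collect_empty_eq mem_Collect_eq)
qed

theorem lemma1p2:
  fixes n :: nat
  assumes "n > 1"
  shows "\<exists>P. optimal_matrix n P"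
proof -
  define column where "column q \<longleftrightarrow> (\<exists>m. dom q \<subseteq> UNIV \<times> {m})" for q :: "nat \<times> nat \<rightharpoonup> nat"
  define R where
    "R = {q :: nat \<times> nat \<rightharpoonup> nat. finite (dom q) \<and> (column q \<or> card (dom q) \<le> n)}"
  have "countable R"
    by (rule countable_subset[OF _ countable_finite_maps]) (auto simp: R_def)
  moreover have "Map.empty \<in> R"
    by (simp add: R_def)
  ultimately obtain p :: "nat \<Rightarrow> nat \<times> nat \<rightharpoonup> nat"
    where p: "range p \<subseteq> R" "\<And>q. q \<in> R \<Longrightarrow> infinite {x. p x = q}"
    using countable_enumerated_infinitely_often[of R] by blast
  obtain F where
    F_column: "\<And>x. column (p x) \<Longrightarrow> p x \<subseteq>\<^sub>m Some \<circ> F x" and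
    F_served: "\<And>x. \<exists>y\<le>x. p x \<subseteq>\<^sub>m Some \<circ> F y" and
    F_agree: "\<And>x y c. y < x \<Longrightarrow> F x c = F y c \<Longrightarrow>
      c \<in> dom (p x) \<and> (column (p x) \<or> (\<forall>z<x. \<not> p x \<subseteq>\<^sub>m Some \<circ> F z))"
    using exists_sequence_serving_constraints[of "\<lambda>x. column (p x)" p] by blast
  define P where "P k m i = {x. F x (k, m) = i}" for k m i

  have column_infinite: "infinite (\<Inter>l<k. P l m (i l))" for k m i
  proof -
    define q where "q = (\<lambda>(l, m'). if m' = m \<and> l < k then Some (i l) else None)"
    have dom_q: "dom q = {..<k} \<times> {m}"
      by (auto simp: q_def dom_def split: if_splits)
    then have "column q"
      by (auto simp: column_def)
    have "infinite {x. p x = q}"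
      by (rule p(2)) (simp add: R_def dom_q \<open>column q\<close>)
    moreover have "{x. p x = q} \<subseteq> (\<Inter>l<k. P l m (i l))"
    proof clarify
      fix x l
      assume "q = p x" "l < k"
      then have "q \<subseteq>\<^sub>m Some \<circ> F x"
        using F_column \<open>column q\<close> by metis
      then have "q (l, m) = (Some \<circ> F x) (l, m)"
        using dom_q \<open>l < k\<close> by (auto simp: map_le_def)
      then show "x \<in> P l m (i l)"
        using \<open>l < k\<close> by (simp add: q_def P_def)
    qed
    ultimately show ?thesis
      using finite_subset by blast
  qed

  have "infinite_partition (P k m)" for k m
  proof -
    have "\<exists>x. F x (k, m) = i" for i
    proof -
      have "(\<Inter>l<Suc k. P l m i) \<noteq> {}"
        using column_infinite[where k = "Suc k" and m = m and i = "\<lambda>_. i"] by (metis finite.emptyI)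
      then show ?thesis
        by (auto simp: P_def)
    qed
    then have "surj (\<lambda>x. F x (k, m))"
      by (metis surjI)
    from infinite_partition_fibres[OF this] show ?thesis
      by (simp add: P_def[abs_def])
  qed
  moreover have "columnwise_agreement n P"
    using column_infinite by (simp add: columnwise_agreement_def)
  moreover have "n_optimality n P"
    unfolding n_optimality_def
  proof (intro allI impI)
    fix i k m :: "nat \<Rightarrow> nat"
    assume distinct: "\<forall>l<n. \<forall>j<l. (k j, m j) \<noteq> (k l, m l)"
      and mixed: "\<exists>j<n. \<exists>l<n. m j \<noteq> m l"
    define c where "c j = (k j, m j)" for j
    have inj: "inj_on c {..<n}"
      using distinct by (intro linorder_inj_onI) (auto simp: c_def)
    define D where "D = c ` {..<n}"
    have card_D: "card D = n"
      using inj by (simp add: D_def card_image)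
    have mixed_D: "\<not> D \<subseteq> UNIV \<times> {m'}" for m'
      using mixed by (auto simp: D_def c_def)
    define q where
      "q d = (if d \<in> D then Some (i (the_inv_into {..<n} c d)) else None)" for d
    have dom_q: "dom q = D"
      by (auto simp: q_def dom_def)
    have q_c: "q (c j) = Some (i j)" if "j < n" for j
      using that inj by (simp add: q_def D_def the_inv_into_f_f)

    have piece: "x \<in> (\<Inter>j<n. P (k j) (m j) (i j)) \<longleftrightarrow> q \<subseteq>\<^sub>m Some \<circ> F x" for x
      by (auto simp: map_le_def dom_q D_def q_c P_def c_def[symmetric])

    have unique: False if "y < x" "q \<subseteq>\<^sub>m Some \<circ> F x" "q \<subseteq>\<^sub>m Some \<circ> F y" for x y
    proof -
      have agree: "F x d = F y d" if "d \<in> D" for d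
        using that \<open>q \<subseteq>\<^sub>m Some \<circ> F x\<close> \<open>q \<subseteq>\<^sub>m Some \<circ> F y\<close>
        by (metis comp_apply dom_q map_le_def option.inject)
      have D_sub: "D \<subseteq> dom (p x)"
        using F_agree[OF \<open>y < x\<close> agree] by blast
      then have "\<not> column (p x)"
        using mixed_D unfolding column_def by blast
      moreover have "p x \<in> R"
        using p(1) by blast
      ultimately have "dom (p x) = D"
        using D_sub card_D by (metis (mono_tags, lifting) R_def card_seteq mem_Collect_eq)
      obtain d where "d \<in> D"
        using mixed_D by blast
      then have new: "\<not> p x \<subseteq>\<^sub>m Some \<circ> F z" if "z < x" for z
        using F_agree[OF \<open>y < x\<close> agree] \<open>\<not> column (p x)\<close> that by blast
      \<comment> \<open>As no earlier point extends \<open>p x\<close>, it is \<open>x\<close> that does, and the agreement on \<open>D\<close> passes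
        this on to the earlier point \<open>y\<close>.\<close>
      then have "p x \<subseteq>\<^sub>m Some \<circ> F x"
        using F_served[of x] by (metis le_neq_implies_less)
      then have "p x \<subseteq>\<^sub>m Some \<circ> F y"
        using agree \<open>dom (p x) = D\<close> by (simp add: map_le_def)
      with new \<open>y < x\<close> show False
        by blast
    qed

    have "q \<in> R"
      using dom_q card_D by (simp add: R_def D_def)
    then obtain x where "p x = q"
      using p(2) by (metis (mono_tags) empty_Collect_eq finite.emptyI)
    then obtain y where y: "q \<subseteq>\<^sub>m Some \<circ> F y"
      using F_served by metis
    have "(\<Inter>j<n. P (k j) (m j) (i j)) = {y}"
    proof (intro equalityI subsetI)
      fix x
      assume "x \<in> (\<Inter>j<n. P (k j) (m j) (i j))"
      then have "q \<subseteq>\<^sub>m Some \<circ> F x"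
        using piece by blast
      then show "x \<in> {y}"
        using y unique[of x y] unique[of y x] by (cases x y rule: linorder_cases) auto
    qed (use y piece in auto)
    then show "is_singleton (\<Inter>j<n. P (k j) (m j) (i j))"
      by simp
  qed
  ultimately have "optimal_matrix n P"
    by (simp add: optimal_matrix_def)
  then show ?thesis
    by blast
qed

end
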